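(* Let $X$ be a based space having the based homotopy type of a CW-complex, and let $n\geq 0$ be an integer. If $X$ is $n$-connected and $\mathcal{E}(X)\neq[X,X]$, then $N\mathcal{E}(X)\geq n+1$.
   Context: All maps and homotopies preserve base points. For a connected space $X$, $[X,X]$ is the monoid (under composition) of based homotopy classes of based self-maps of $X$, and $\mathcal{E}(X)\subseteq[X,X]$ is the group of classes of self-homotopy equivalences. For a nonnegative integer $k$, $\mathcal{A}_\sharp^k(X)\subseteq[X,X]$ is the set of classes $f$ such that the induced map $\pi_i(f):\pi_i(X)\to\pi_i(X)$ is an isomorphism for all $i=0,1,\dots,k$. One always has $\mathcal{E}(X)\subseteq\mathcal{A}_\sharp^k(X)$. The self-closeness number of $X$ is $N\mathcal{E}(X)=\min\{k\geq 0 : \mathcal{A}_\sharp^k(X)=\mathcal{E}(X)\}$, with $N\mathcal{E}(X)=\infty$ if no such nonnegative integer $k$ exists. *)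

theory Defs
  imports
    "HOL-Analysis.Analysis"
    "HOL-Algebra.Group"
    "HOL-Library.Extended_Nat"
begin

section \<open>Based maps and based homotopy classes\<close>

definition based_map :: "'a topology \<Rightarrow> 'a \<Rightarrow> 'b topology \<Rightarrow> 'b \<Rightarrow> ('a \<Rightarrow> 'b) \<Rightarrow> bool" where
  "based_map X x Y y f \<longleftrightarrow> continuous_map X Y f \<and> f x = y"

definition based_homotopic ::
    "'a topology \<Rightarrow> 'a \<Rightarrow> 'b topology \<Rightarrow> 'b \<Rightarrow> ('a \<Rightarrow> 'b) \<Rightarrow> ('a \<Rightarrow> 'b) \<Rightarrow> bool" where
  "based_homotopic X x Y y = homotopic_with (\<lambda>h. h x = y) X Y"

definition based_class ::
    "'a topology \<Rightarrow> 'a \<Rightarrow> 'b topology \<Rightarrow> 'b \<Rightarrow> ('a \<Rightarrow> 'b) \<Rightarrow> ('a \<Rightarrow> 'b) set" where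
  "based_class X x Y y f = {g. based_homotopic X x Y y f g}"

definition based_homotopy_equivalence ::
    "'a topology \<Rightarrow> 'a \<Rightarrow> 'b topology \<Rightarrow> 'b \<Rightarrow> ('a \<Rightarrow> 'b) \<Rightarrow> bool" where
  "based_homotopy_equivalence X x Y y f \<longleftrightarrow>
     based_map X x Y y f \<and>
     (\<exists>g. based_map Y y X x g \<and>
          based_homotopic X x X x (g \<circ> f) id \<and>
          based_homotopic Y y Y y (f \<circ> g) id)"

definition based_homotopy_equivalent ::
    "'a topology \<Rightarrow> 'a \<Rightarrow> 'b topology \<Rightarrow> 'b \<Rightarrow> bool" where
  "based_homotopy_equivalent X x Y y \<longleftrightarrow> (\<exists>f. based_homotopy_equivalence X x Y y f)"


section \<open>CW-complexes\<close>

definition unit_disc :: "nat \<Rightarrow> (nat \<Rightarrow> real) topology" where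
  "unit_disc n = subtopology (Euclidean_space n) {x. (\<Sum>i<n. (x i)\<^sup>2) \<le> 1}"

definition disc_interior :: "nat \<Rightarrow> (nat \<Rightarrow> real) set" where
  "disc_interior n = {x \<in> topspace (unit_disc n). (\<Sum>i<n. (x i)\<^sup>2) < 1}"

definition disc_boundary :: "nat \<Rightarrow> (nat \<Rightarrow> real) set" where
  "disc_boundary n = {x \<in> topspace (unit_disc n). (\<Sum>i<n. (x i)\<^sup>2) = 1}"

text \<open>\<open>cells n\<close> is the set of open \<open>n\<close>-cells. The conditions are, in order: the space is
  Hausdorff; it is the disjoint union of the cells; every cell has a characteristic map,
  whose boundary values lie in finitely many cells of smaller dimension; and the
  space carries the weak topology with respect to the closures of its cells.\<close>

definition cw_structure :: "'a topology \<Rightarrow> (nat \<Rightarrow> 'a set set) \<Rightarrow> bool" where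
  "cw_structure Y cells \<longleftrightarrow>
     Hausdorff_space Y \<and>
     (\<Union>n. \<Union>(cells n)) = topspace Y \<and>
     (\<forall>m n d e. d \<in> cells m \<and> e \<in> cells n \<and> (m \<noteq> n \<or> d \<noteq> e) \<longrightarrow> disjnt d e) \<and>
     (\<forall>n. \<forall>e \<in> cells n. \<exists>\<phi>.
        continuous_map (unit_disc n) Y \<phi> \<and>
        homeomorphic_map (subtopology (unit_disc n) (disc_interior n)) (subtopology Y e) \<phi> \<and>
        (\<exists>\<F>. finite \<F> \<and> \<F> \<subseteq> (\<Union>m<n. cells m) \<and> \<phi> ` disc_boundary n \<subseteq> \<Union>\<F>)) \<and>
     (\<forall>A \<subseteq> topspace Y.
        (\<forall>n. \<forall>e \<in> cells n. closedin Y (A \<inter> (Y closure_of e))) \<longrightarrow> closedin Y A)"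

definition CW_complex :: "'a topology \<Rightarrow> bool" where
  "CW_complex Y \<longleftrightarrow> (\<exists>cells. cw_structure Y cells)"


section \<open>Homotopy groups\<close>

definition unit_cube :: "nat \<Rightarrow> (nat \<Rightarrow> real) topology" where
  "unit_cube n = subtopology (Euclidean_space n) {t. \<forall>i<n. 0 \<le> t i \<and> t i \<le> 1}"

definition cube_boundary :: "nat \<Rightarrow> (nat \<Rightarrow> real) set" where
  "cube_boundary n = {t \<in> topspace (unit_cube n). \<exists>i<n. t i = 0 \<or> t i = 1}"

definition spheroid :: "nat \<Rightarrow> 'a topology \<Rightarrow> 'a \<Rightarrow> ((nat \<Rightarrow> real) \<Rightarrow> 'a) \<Rightarrow> bool" where
  "spheroid n X x a \<longleftrightarrow> continuous_map (unit_cube n) X a \<and> (\<forall>t \<in> cube_boundary n. a t = x)"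

definition spheroid_class ::
    "nat \<Rightarrow> 'a topology \<Rightarrow> 'a \<Rightarrow> ((nat \<Rightarrow> real) \<Rightarrow> 'a) \<Rightarrow> ((nat \<Rightarrow> real) \<Rightarrow> 'a) set" where
  "spheroid_class n X x a =
     {b. homotopic_with (\<lambda>h. \<forall>t \<in> cube_boundary n. h t = x) (unit_cube n) X a b}"

definition spheroid_join ::
    "((nat \<Rightarrow> real) \<Rightarrow> 'a) \<Rightarrow> ((nat \<Rightarrow> real) \<Rightarrow> 'a) \<Rightarrow> (nat \<Rightarrow> real) \<Rightarrow> 'a" where
  "spheroid_join a b =
     (\<lambda>t. if t 0 \<le> 1/2 then a (t(0 := 2 * t 0)) else b (t(0 := 2 * t 0 - 1)))"

text \<open>For \<open>n = 0\<close> the cube is a point with empty boundary, so the carrier is the set of path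
  components of \<open>X\<close>, with the component of \<open>x\<close> as distinguished element; the
  multiplication is meaningful only for \<open>n \<ge> 1\<close>.\<close>

definition homotopy_group ::
    "nat \<Rightarrow> 'a topology \<Rightarrow> 'a \<Rightarrow> ((nat \<Rightarrow> real) \<Rightarrow> 'a) set monoid" where
  "homotopy_group n X x =
     \<lparr>carrier = {spheroid_class n X x a | a. spheroid n X x a},
      mult = (\<lambda>A B. \<Union>a\<in>A. \<Union>b\<in>B. spheroid_class n X x (spheroid_join a b)),
      one = spheroid_class n X x (\<lambda>_. x)\<rparr>"

definition homotopy_induced ::
    "nat \<Rightarrow> 'b topology \<Rightarrow> 'b \<Rightarrow> ('a \<Rightarrow> 'b) \<Rightarrow> ((nat \<Rightarrow> real) \<Rightarrow> 'a) set \<Rightarrow> ((nat \<Rightarrow> real) \<Rightarrow> 'b) set"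
  where
  "homotopy_induced n Y y f A = (\<Union>a\<in>A. spheroid_class n Y y (f \<circ> a))"

text \<open>In degree \<open>0\<close> there is no group structure, and isomorphism means bijection.\<close>

definition induces_iso ::
    "nat \<Rightarrow> 'a topology \<Rightarrow> 'a \<Rightarrow> 'b topology \<Rightarrow> 'b \<Rightarrow> ('a \<Rightarrow> 'b) \<Rightarrow> bool" where
  "induces_iso n X x Y y f \<longleftrightarrow>
     (if n = 0
      then bij_betw (homotopy_induced n Y y f)
             (carrier (homotopy_group n X x)) (carrier (homotopy_group n Y y))
      else homotopy_induced n Y y f \<in> iso (homotopy_group n X x) (homotopy_group n Y y))"

definition n_connected :: "nat \<Rightarrow> 'a topology \<Rightarrow> 'a \<Rightarrow> bool" where
  "n_connected n X x \<longleftrightarrow>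
     path_connected_space X \<and>
     (\<forall>i\<in>{1..n}. carrier (homotopy_group i X x) = {\<one>\<^bsub>homotopy_group i X x\<^esub>})"


section \<open>Self-maps and the self-closeness number\<close>

definition self_map_classes :: "'a topology \<Rightarrow> 'a \<Rightarrow> ('a \<Rightarrow> 'a) set set" where
  "self_map_classes X x = {based_class X x X x f | f. based_map X x X x f}"

definition self_equivalence_classes :: "'a topology \<Rightarrow> 'a \<Rightarrow> ('a \<Rightarrow> 'a) set set" where
  "self_equivalence_classes X x =
     {based_class X x X x f | f. based_homotopy_equivalence X x X x f}"

definition A_sharp :: "nat \<Rightarrow> 'a topology \<Rightarrow> 'a \<Rightarrow> ('a \<Rightarrow> 'a) set set" where
  "A_sharp k X x =
     {based_class X x X x f | f. based_map X x X x f \<and> (\<forall>i\<le>k. induces_iso i X x X x f)}"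

definition self_closeness_number :: "'a topology \<Rightarrow> 'a \<Rightarrow> enat" where
  "self_closeness_number X x =
     (if \<exists>k. A_sharp k X x = self_equivalence_classes X x
      then enat (LEAST k. A_sharp k X x = self_equivalence_classes X x)
      else \<infinity>)"

end

theory Submission
  imports Defs
begin

text \<open>If \<open>X\<close> is \<open>n\<close>-connected, then \<open>\<pi>\<^sub>i(X)\<close> is trivial for every \<open>i \<le> n\<close>, so any based self-map
  whatsoever induces an isomorphism in these degrees: a map between one-element groups (in degree
  \<open>0\<close>, between one-point sets of path components) is an
  isomorphism. Hence \<open>A_sharp k X x\<close> is all of \<open>[X, X]\<close> for every \<open>k \<le> n\<close>, and since some self-map
  is not an equivalence, no such \<open>k\<close> can realise the self-closeness number.

  The topological content is small: a path-connected space has one homotopy class of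
  \<open>0\<close>-spheroids (\<open>carrier_homotopy_group_0\<close>), and juxtaposing two spheroids gives a spheroid
  (\<open>spheroid_join\<close>). The latter is needed because the multiplication of
  \<open>homotopy_group\<close> is a raw operation on sets of maps; that the unit is idempotent, without which
  a map of one-element carriers need not be multiplicative, rests on it.\<close>

section \<open>Spheroids\<close>

lemma topspace_unit_cube:
  "topspace (unit_cube n) = {t. (\<forall>i\<ge>n. t i = 0) \<and> (\<forall>i<n. 0 \<le> t i \<and> t i \<le> 1)}"
  by (auto simp: unit_cube_def topspace_Euclidean_space)

lemma cube_boundaryI:
  "t \<in> topspace (unit_cube n) \<Longrightarrow> i < n \<Longrightarrow> t i = 0 \<or> t i = 1 \<Longrightarrow> t \<in> cube_boundary n"
  by (auto simp: cube_boundary_def)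

lemma continuous_map_unit_cube_component:
  "continuous_map (unit_cube n) euclideanreal (\<lambda>t. t i)"
  unfolding unit_cube_def Euclidean_space_def
  by (intro continuous_map_from_subtopology continuous_map_product_projection) simp

lemma continuous_map_into_unit_cube:
  assumes "\<And>i. continuous_map Z euclideanreal (\<lambda>z. f z i)"
    and "\<And>z. z \<in> topspace Z \<Longrightarrow> f z \<in> topspace (unit_cube n)"
  shows "continuous_map Z (unit_cube n) f"
  using assms
  by (auto simp: unit_cube_def Euclidean_space_def continuous_map_in_subtopology
      continuous_map_componentwise_UNIV image_subset_iff Pi_iff)

lemma continuous_map_reparametrise_first:
  assumes n: "0 < n"
    and p: "continuous_map (unit_cube n) euclideanreal p"
    and S: "\<And>t. t \<in> topspace (unit_cube n) \<Longrightarrow> t \<in> S \<Longrightarrow> 0 \<le> p t \<and> p t \<le> 1"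
  shows "continuous_map (subtopology (unit_cube n) S) (unit_cube n) (\<lambda>t. t(0 := p t))"
proof (rule continuous_map_into_unit_cube)
  fix i
  show "continuous_map (subtopology (unit_cube n) S) euclideanreal (\<lambda>t. (t(0 := p t)) i)"
    using p continuous_map_unit_cube_component
    by (cases "i = 0") (auto intro: continuous_map_from_subtopology)
next
  fix t assume "t \<in> topspace (subtopology (unit_cube n) S)"
  with n S[of t] show "t(0 := p t) \<in> topspace (unit_cube n)"
    by (auto simp: topspace_unit_cube)
qed

text \<open>The two halves of the cube overlap in the face \<open>t 0 = 1/2\<close>, which is rescaled into the
  boundary for both maps; there both take the value \<open>x\<close>, so they can be glued.\<close>

lemma spheroid_join:
  assumes n: "0 < n" and a: "spheroid n X x a" and b: "spheroid n X x b"
  shows "spheroid n X x (spheroid_join a b)"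
proof -
  let ?C = "unit_cube n"
  have ca: "continuous_map ?C X a" and cb: "continuous_map ?C X b"
    and ba: "\<And>t. t \<in> cube_boundary n \<Longrightarrow> a t = x"
    and bb: "\<And>t. t \<in> cube_boundary n \<Longrightarrow> b t = x"
    using a b by (auto simp: spheroid_def)
  have range: "0 \<le> t 0 \<and> t 0 \<le> 1" if "t \<in> topspace ?C" for t
    using that n by (simp add: topspace_unit_cube)
  have L: "t(0 := 2 * t 0) \<in> topspace ?C" if "t \<in> topspace ?C" "t 0 \<le> 1/2" for t
    using that n by (auto simp: topspace_unit_cube)
  have R: "t(0 := 2 * t 0 - 1) \<in> topspace ?C" if "t \<in> topspace ?C" "1/2 \<le> t 0" for t
    using that n by (auto simp: topspace_unit_cube)
  have "continuous_map ?C X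
      (\<lambda>t. if t 0 \<le> 1/2 then a (t(0 := 2 * t 0)) else b (t(0 := 2 * t 0 - 1)))"
  proof (rule continuous_map_cases_le)
    show "continuous_map ?C euclideanreal (\<lambda>t. t 0)"
      by (rule continuous_map_unit_cube_component)
    show "continuous_map ?C euclideanreal (\<lambda>t. 1/2)"
      by simp
    have "continuous_map (subtopology ?C {t \<in> topspace ?C. t 0 \<le> 1/2}) ?C (\<lambda>t. t(0 := 2 * t 0))"
    proof (rule continuous_map_reparametrise_first[OF n])
      show "continuous_map ?C euclideanreal (\<lambda>t. 2 * t 0)"
        by (intro continuous_map_real_mult_left continuous_map_unit_cube_component)
    qed (use range in auto)
    from continuous_map_compose[OF this ca]
    show "continuous_map (subtopology ?C {t \<in> topspace ?C. t 0 \<le> 1/2}) X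
        (\<lambda>t. a (t(0 := 2 * t 0)))"
      by (simp add: o_def)
    have "continuous_map (subtopology ?C {t \<in> topspace ?C. 1/2 \<le> t 0}) ?C
        (\<lambda>t. t(0 := 2 * t 0 - 1))"
    proof (rule continuous_map_reparametrise_first[OF n])
      show "continuous_map ?C euclideanreal (\<lambda>t. 2 * t 0 - 1)"
        by (intro continuous_map_diff continuous_map_real_mult_left
            continuous_map_unit_cube_component) simp
    qed (use range in auto)
    from continuous_map_compose[OF this cb]
    show "continuous_map (subtopology ?C {t \<in> topspace ?C. 1/2 \<le> t 0}) X
        (\<lambda>t. b (t(0 := 2 * t 0 - 1)))"
      by (simp add: o_def)
    fix t assume t: "t \<in> topspace ?C" "t 0 = 1/2"
    have "a (t(0 := 2 * t 0)) = x"
      by (intro ba cube_boundaryI[OF L n]) (use t in auto)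
    moreover have "b (t(0 := 2 * t 0 - 1)) = x"
      by (intro bb cube_boundaryI[OF R n]) (use t in auto)
    ultimately show "a (t(0 := 2 * t 0)) = b (t(0 := 2 * t 0 - 1))"
      by simp
  qed
  moreover have "spheroid_join a b t = x" if bd: "t \<in> cube_boundary n" for t
  proof -
    obtain i where i: "i < n" "t i = 0 \<or> t i = 1" and t: "t \<in> topspace ?C"
      using bd by (auto simp: cube_boundary_def)
    show ?thesis
    proof (cases "t 0 \<le> 1/2")
      case True
      have "a (t(0 := 2 * t 0)) = x"
        by (intro ba cube_boundaryI[OF L i(1)]) (use True i t in auto)
      with True show ?thesis by (simp add: spheroid_join_def)
    next
      case False
      have "b (t(0 := 2 * t 0 - 1)) = x"
        by (intro bb cube_boundaryI[OF R i(1)]) (use False i t in auto)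
      with False show ?thesis by (simp add: spheroid_join_def)
    qed
  qed
  ultimately show ?thesis
    by (simp add: spheroid_def spheroid_join_def[abs_def])
qed

lemma spheroid_const: "x \<in> topspace X \<Longrightarrow> spheroid n X x (\<lambda>_. x)"
  by (simp add: spheroid_def)

lemma spheroid_compose:
  "based_map X x Y y f \<Longrightarrow> spheroid n X x a \<Longrightarrow> spheroid n Y y (f \<circ> a)"
  unfolding spheroid_def based_map_def by (metis comp_apply continuous_map_compose)

lemma spheroid_class_refl:
  "spheroid n X x a \<Longrightarrow> a \<in> spheroid_class n X x a"
  by (simp add: spheroid_class_def spheroid_def homotopic_with_refl)

lemma spheroid_of_mem_class:
  assumes "b \<in> spheroid_class n X x a"
  shows "spheroid n X x b"
proof -
  have "homotopic_with (\<lambda>h. \<forall>t \<in> cube_boundary n. h t = x) (unit_cube n) X a b"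
    using assms by (simp add: spheroid_class_def)
  from homotopic_with_imp_continuous_maps[OF this] homotopic_with_imp_property[OF this]
  show ?thesis by (simp add: spheroid_def)
qed

section \<open>Trivial homotopy groups\<close>

text \<open>The \<open>0\<close>-cube is a single point with empty boundary, so a \<open>0\<close>-spheroid is a point of \<open>X\<close> and
  a homotopy of \<open>0\<close>-spheroids is a path.\<close>

lemma carrier_homotopy_group_0:
  assumes X: "path_connected_space X" and x: "x \<in> topspace X"
  shows "carrier (homotopy_group 0 X x) = {\<one>\<^bsub>homotopy_group 0 X x\<^esub>}"
proof -
  have "spheroid_class 0 X x a = spheroid_class 0 X x (\<lambda>_. x)" if a: "spheroid 0 X x a" for a
  proof -
    have top: "topspace (unit_cube 0) = {\<lambda>_. 0}"
      by (auto simp: topspace_unit_cube)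
    have [simp]: "cube_boundary 0 = {}"
      by (simp add: cube_boundary_def)
    have "a (\<lambda>_. 0) \<in> topspace X"
      using a top by (auto simp: spheroid_def continuous_map_def)
    then have "homotopic_with (\<lambda>_. True) (unit_cube 0) X (\<lambda>_. a (\<lambda>_. 0)) (\<lambda>_. x)"
      using X x by (simp add: homotopic_constant_maps path_connected_space_iff_path_component)
    then have "homotopic_with (\<lambda>_. True) (unit_cube 0) X a (\<lambda>_. x)"
      by (rule homotopic_with_eq) (auto simp: top)
    then show ?thesis
      unfolding spheroid_class_def
      by (intro Collect_cong) (simp, meson homotopic_with_symD homotopic_with_trans)
  qed
  then have "{spheroid_class 0 X x a |a. spheroid 0 X x a} = {spheroid_class 0 X x (\<lambda>_. x)}"
    using spheroid_const[OF x] by blast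
  then show ?thesis
    by (simp add: homotopy_group_def)
qed

lemma carrier_homotopy_group_n_connected:
  assumes "n_connected n X x" and "x \<in> topspace X" and "i \<le> n"
  shows "carrier (homotopy_group i X x) = {\<one>\<^bsub>homotopy_group i X x\<^esub>}"
  using assms carrier_homotopy_group_0[of X x]
  by (cases "i = 0") (auto simp: n_connected_def)

lemma spheroid_class_eq_one:
  assumes "carrier (homotopy_group n X x) = {\<one>\<^bsub>homotopy_group n X x\<^esub>}"
    and "spheroid n X x a"
  shows "spheroid_class n X x a = \<one>\<^bsub>homotopy_group n X x\<^esub>"
proof -
  have "spheroid_class n X x a \<in> carrier (homotopy_group n X x)"
    using assms(2) by (auto simp: homotopy_group_def)
  with assms(1) show ?thesis by simp
qed

lemma
  assumes x: "x \<in> topspace X"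
  shows const_mem_one: "(\<lambda>_. x) \<in> \<one>\<^bsub>homotopy_group n X x\<^esub>"
    and spheroid_of_mem_one: "a \<in> \<one>\<^bsub>homotopy_group n X x\<^esub> \<Longrightarrow> spheroid n X x a"
  using spheroid_class_refl[OF spheroid_const[OF x]]
  by (auto simp: homotopy_group_def dest: spheroid_of_mem_class)

text \<open>Multiplication and induced map are unions over all representatives. When every
  spheroid represents the unit, all members of these unions agree, and the unions are nonempty
  because the constant spheroid is a representative.\<close>

lemma one_mult_one_of_trivial:
  assumes "carrier (homotopy_group n X x) = {\<one>\<^bsub>homotopy_group n X x\<^esub>}"
    and x: "x \<in> topspace X" and n: "0 < n"
  shows "\<one>\<^bsub>homotopy_group n X x\<^esub> \<otimes>\<^bsub>homotopy_group n X x\<^esub> \<one>\<^bsub>homotopy_group n X x\<^esub>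
    = \<one>\<^bsub>homotopy_group n X x\<^esub>"
proof -
  let ?e = "\<one>\<^bsub>homotopy_group n X x\<^esub>"
  have "spheroid_class n X x (spheroid_join a b) = ?e" if "a \<in> ?e" "b \<in> ?e" for a b
    using that by (intro spheroid_class_eq_one assms(1) spheroid_join n spheroid_of_mem_one x)
  moreover have "?e \<noteq> {}"
    using const_mem_one[OF x] by auto
  ultimately have "(\<Union>a\<in>?e. \<Union>b\<in>?e. spheroid_class n X x (spheroid_join a b)) = ?e"
    by (simp cong: SUP_cong)
  then show ?thesis
    by (simp add: homotopy_group_def)
qed

lemma homotopy_induced_one_of_trivial:
  assumes "carrier (homotopy_group n Y y) = {\<one>\<^bsub>homotopy_group n Y y\<^esub>}"
    and f: "based_map X x Y y f" and x: "x \<in> topspace X"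
  shows "homotopy_induced n Y y f \<one>\<^bsub>homotopy_group n X x\<^esub> = \<one>\<^bsub>homotopy_group n Y y\<^esub>"
proof -
  have "spheroid_class n Y y (f \<circ> a) = \<one>\<^bsub>homotopy_group n Y y\<^esub>"
    if "a \<in> \<one>\<^bsub>homotopy_group n X x\<^esub>" for a
    using that by (intro spheroid_class_eq_one assms(1) spheroid_compose[OF f] spheroid_of_mem_one x)
  with const_mem_one[OF x, of n] show ?thesis
    unfolding homotopy_induced_def by auto
qed

lemma induces_iso_of_trivial:
  assumes X: "carrier (homotopy_group n X x) = {\<one>\<^bsub>homotopy_group n X x\<^esub>}"
    and Y: "carrier (homotopy_group n Y y) = {\<one>\<^bsub>homotopy_group n Y y\<^esub>}"
    and f: "based_map X x Y y f" and x: "x \<in> topspace X"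
  shows "induces_iso n X x Y y f"
proof -
  have y: "y \<in> topspace Y"
    using f x by (auto simp: based_map_def continuous_map_def)
  note one = homotopy_induced_one_of_trivial[OF Y f x]
  have bij: "bij_betw (homotopy_induced n Y y f)
      (carrier (homotopy_group n X x)) (carrier (homotopy_group n Y y))"
    by (simp add: X Y one)
  show ?thesis
  proof (cases "n = 0")
    case True
    with bij show ?thesis by (simp add: induces_iso_def)
  next
    case False
    then have "homotopy_induced n Y y f \<in> iso (homotopy_group n X x) (homotopy_group n Y y)"
      using bij one_mult_one_of_trivial[OF X x] one_mult_one_of_trivial[OF Y y]
      by (simp add: iso_def hom_def X Y one)
    with False show ?thesis by (simp add: induces_iso_def)
  qed
qed

section \<open>The self-closeness number\<close>

lemma A_sharp_n_connected:
  assumes "n_connected n X x" and "x \<in> topspace X" and "k \<le> n"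
  shows "A_sharp k X x = self_map_classes X x"
proof -
  have "induces_iso i X x X x f" if "based_map X x X x f" "i \<le> k" for i f
    using that assms
    by (intro induces_iso_of_trivial carrier_homotopy_group_n_connected[of n]) auto
  then show ?thesis
    by (auto simp: A_sharp_def self_map_classes_def)
qed

theorem lemma4:
  fixes X :: "'a topology" and x\<^sub>0 :: 'a
    and Y :: "'b topology" and y\<^sub>0 :: 'b
    and n :: nat
  assumes "x\<^sub>0 \<in> topspace X"
    and "CW_complex Y" and "y\<^sub>0 \<in> topspace Y"
    and "based_homotopy_equivalent X x\<^sub>0 Y y\<^sub>0"
    and "n_connected n X x\<^sub>0"
    and "self_equivalence_classes X x\<^sub>0 \<noteq> self_map_classes X x\<^sub>0"
  shows "self_closeness_number X x\<^sub>0 \<ge> enat (n + 1)"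
proof -
  let ?P = "\<lambda>k. A_sharp k X x\<^sub>0 = self_equivalence_classes X x\<^sub>0"
  have gt: "n + 1 \<le> k" if "?P k" for k
    using that A_sharp_n_connected[OF assms(5,1), of k] assms(6) by (cases "k \<le> n") auto
  show ?thesis
  proof (cases "\<exists>k. ?P k")
    case True
    then have "n + 1 \<le> (LEAST k. ?P k)"
      by (rule gt[OF LeastI_ex])
    with True show ?thesis by (simp add: self_closeness_number_def)
  next
    case False
    then show ?thesis by (simp add: self_closeness_number_def)
  qed
qed

end
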